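(* Let $X$ be a compact Hausdorff, nowhere c.c.c. $F$-space. Then every continuous open finite-to-one map $f\colon X\to X$ is a weak $P$-point in $C_k(X,X)$.
   Context: $C_k(X,X)$ denotes the set of continuous functions $X\to X$ with the compact-open topology, generated by the subbasis of sets $[C,U]=\{f : f(C)\subseteq U\}$ with $C\subseteq X$ compact and $U\subseteq X$ open. A zero-set in a Tychonoff space $X$ is a set of the form $g^{-1}(0)$ with $g\colon X\to\mathbb{R}$ continuous, and a cozero-set is the complement of a zero-set. A subspace $Y\subseteq X$ is $C^*$-embedded if every bounded continuous real-valued function on $Y$ extends to a continuous function on $X$. A (Tychonoff) space is an $F$-space if each of its cozero-sets is $C^*$-embedded. A space is c.c.c. if every family of pairwise disjoint non-empty open subsets is countable; it is nowhere c.c.c. if no non-empty open subspace is c.c.c. A map is finite-to-one if all its fibres are finite. A weak $P$-point is a point $p$ that does not lie in the boundary of any countable set, i.e. $p\notin\overline{D}$ for every countable set $D$ with $p\notin D$. *)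

theory Defs
  imports "HOL-Analysis.Analysis"
begin

text \<open>
  Continuous maps from \<open>X\<close> to \<open>Y\<close> are represented extensionally (with value \<open>undefined\<close>
  outside \<open>topspace X\<close>), so that distinct HOL functions are distinct maps of spaces.
\<close>

definition continuous_maps :: "'a topology \<Rightarrow> 'b topology \<Rightarrow> ('a \<Rightarrow> 'b) set" where
  "continuous_maps X Y = {f \<in> extensional (topspace X). continuous_map X Y f}"

definition compact_open_topology :: "'a topology \<Rightarrow> 'b topology \<Rightarrow> ('a \<Rightarrow> 'b) topology" where
  "compact_open_topology X Y =
     topology_generated_by
       {{f \<in> continuous_maps X Y. f ` C \<subseteq> U} | C U. compactin X C \<and> openin Y U}"

text \<open>The subbasic set given by the empty compact set is the whole function space.\<close>

lemma topspace_compact_open_topology [simp]: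
  "topspace (compact_open_topology X Y) = continuous_maps X Y"
proof -
  have "continuous_maps X Y \<in>
      {{f \<in> continuous_maps X Y. f ` C \<subseteq> U} | C U. compactin X C \<and> openin Y U}"
    by (rule CollectI, rule exI[of _ "{}"], rule exI[of _ "{}"]) auto
  then show ?thesis
    unfolding compact_open_topology_def topology_generated_by_topspace by blast
qed

definition zero_set_in :: "'a topology \<Rightarrow> 'a set \<Rightarrow> bool" where
  "zero_set_in X Z \<longleftrightarrow>
     (\<exists>g. continuous_map X euclideanreal g \<and> Z = {x \<in> topspace X. g x = 0})"

definition cozero_set_in :: "'a topology \<Rightarrow> 'a set \<Rightarrow> bool" where
  "cozero_set_in X U \<longleftrightarrow> (\<exists>Z. zero_set_in X Z \<and> U = topspace X - Z)"

definition Cstar_embedded_in :: "'a topology \<Rightarrow> 'a set \<Rightarrow> bool" where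
  "Cstar_embedded_in X Y \<longleftrightarrow> Y \<subseteq> topspace X \<and>
     (\<forall>g. continuous_map (subtopology X Y) euclideanreal g \<and> bounded (g ` Y) \<longrightarrow>
        (\<exists>h. continuous_map X euclideanreal h \<and> (\<forall>y\<in>Y. h y = g y)))"

text \<open>Tychonoff means completely regular and Hausdorff; \<open>completely_regular_space\<close> on its
  own includes no separation axiom.\<close>

definition F_space :: "'a topology \<Rightarrow> bool" where
  "F_space X \<longleftrightarrow> completely_regular_space X \<and> Hausdorff_space X \<and>
     (\<forall>U. cozero_set_in X U \<longrightarrow> Cstar_embedded_in X U)"

definition ccc_space :: "'a topology \<Rightarrow> bool" where
  "ccc_space X \<longleftrightarrow>
     (\<forall>\<U>. (\<forall>U\<in>\<U>. openin X U \<and> U \<noteq> {}) \<and> pairwise disjnt \<U> \<longrightarrow> countable \<U>)"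

definition nowhere_ccc_space :: "'a topology \<Rightarrow> bool" where
  "nowhere_ccc_space X \<longleftrightarrow>
     (\<forall>U. openin X U \<and> U \<noteq> {} \<longrightarrow> \<not> ccc_space (subtopology X U))"

definition finite_to_one_on :: "'a set \<Rightarrow> 'b set \<Rightarrow> ('a \<Rightarrow> 'b) \<Rightarrow> bool" where
  "finite_to_one_on A B f \<longleftrightarrow> (\<forall>y\<in>B. finite {x \<in> A. f x = y})"

definition weak_P_point :: "'a topology \<Rightarrow> 'a \<Rightarrow> bool" where
  "weak_P_point T p \<longleftrightarrow> p \<in> topspace T \<and>
     (\<forall>D. D \<subseteq> topspace T \<and> countable D \<and> p \<notin> D \<longrightarrow> p \<notin> T closure_of D)"

end

theory Submission
  imports Defs
begin

text \<open>
  Let \<open>D = {g\<^sub>0, g\<^sub>1, \<dots>}\<close> be a countable set of maps different from \<open>f\<close>. The neighbourhood of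
  \<open>f\<close> that misses \<open>D\<close> comes from points \<open>x\<^sub>k\<close>, one for each \<open>g\<^sub>n\<close>, such that the values
  \<open>y\<^sub>k = f x\<^sub>k\<close> and \<open>z\<^sub>k = g\<^sub>n x\<^sub>k\<close> form two sets with disjoint closures: then \<open>f\<close> lies in \<open>[C, G]\<close>,
  where \<open>C\<close> is the closure of the \<open>x\<^sub>k\<close> and \<open>G\<close> the complement of the closure of the \<open>z\<^sub>k\<close>, and
  no \<open>g\<^sub>n\<close> does.

  In an \<open>F\<close>-space, countable sets have disjoint closures as soon as neither meets the closure of
  the other (\<open>F_space_separated_countable_closures_disjoint\<close>). So it suffices that
  (1) no \<open>y\<^sub>k\<close> is a limit of the \<open>z\<^sub>l\<close> and (2) no \<open>z\<^sub>k\<close> is a limit of the \<open>y\<^sub>l\<close>.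

  For (1), the \<open>y\<^sub>k\<close> get pairwise disjoint open neighbourhoods \<open>V\<^sub>k\<close> that contain no \<open>z\<^sub>l\<close> at all.
  Let \<open>U\<^sub>n\<close> be a non-empty open set with \<open>f(U\<^sub>n)\<close> and \<open>g\<^sub>n(U\<^sub>n)\<close> disjoint. The sets \<open>f(U\<^sub>n)\<close> are open
  because \<open>f\<close> is open, and since \<open>X\<close> is nowhere c.c.c. there is one disjoint open family \<open>\<A>\<close>
  with uncountably many members meeting each of them
  (\<open>disjoint_open_family_meeting_uncountably\<close>). For a fixed choice of \<open>x \<in> U\<^sub>n\<close> with
  \<open>f x \<in> A\<close>, the value \<open>g\<^sub>n x\<close> lies in at most one member of \<open>\<A>\<close>. Avoiding that member
  for all the chosen \<open>A\<close> is a purely combinatorial problem about a function on an uncountable set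
  (\<open>free_selection\<close>).

  For (2), infinitely many points are selected for each \<open>g\<^sub>n\<close>, not just one, so that there is a
  choice left. Disjoint subsets of the discrete set of all \<open>y\<^sub>k\<close> have disjoint closures, so a
  point that is not some \<open>y\<^sub>k\<close> is a limit of at most one out of any almost disjoint family of
  subsets. The selected points are indexed by the nodes of the binary tree; its uncountably many
  branches are almost disjoint, each of them contains one point for every \<open>g\<^sub>n\<close>, and only countably
  many of them are spoilt by some \<open>z\<^sub>k\<close> (\<open>F_space_branch_avoiding\<close>).
\<close>

section \<open>Countable sets in \<open>F\<close>-spaces\<close>

text \<open>
  Each point of \<open>Y\<close> has a function that separates it from \<open>C\<close>; the sum of these functions with
  weights \<open>2\<^sup>-\<^sup>n\<close> converges uniformly.
\<close>

lemma continuous_map_positive_on_countable: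
  assumes creg: "completely_regular_space X" and C: "closedin X C"
    and Y: "countable Y" "Y \<subseteq> topspace X" "Y \<inter> C = {}"
  obtains a :: "'a \<Rightarrow> real" where "continuous_map X euclideanreal a"
    "\<And>x. x \<in> C \<Longrightarrow> a x = 0" "\<And>y. y \<in> Y \<Longrightarrow> a y > 0"
proof (cases "Y = {}")
  case True
  show ?thesis by (rule that[of "\<lambda>_. 0"]) (use True in auto)
next
  case False
  define y where "y = from_nat_into Y"
  have ran: "range y = Y" unfolding y_def by (rule range_from_nat_into[OF False Y(1)])
  have "\<exists>h. continuous_map X (top_of_set {0..1::real}) h \<and> h (y n) = 0 \<and> h ` C \<subseteq> {1}" for n
    using creg C ran Y unfolding completely_regular_space_def by blast
  then obtain h where h: "\<And>n. continuous_map X (top_of_set {0..1::real}) (h n)"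
    "\<And>n. h n (y n) = 0" "\<And>n. h n ` C \<subseteq> {1}" by metis
  define b where "b n x = (1 - h n x) * (1/2)^n" for n x
  have h01: "0 \<le> h n x \<and> h n x \<le> 1" if "x \<in> topspace X" for n x
    using h(1)[of n] that by (auto simp: continuous_map_in_subtopology)
  have hc: "continuous_map X euclideanreal (h n)" for n
    using h(1)[of n] by (auto simp: continuous_map_in_subtopology)
  have b0: "0 \<le> b n x" "b n x \<le> (1/2)^n" if "x \<in> topspace X" for n x
    using h01[OF that, of n] by (auto simp: b_def mult_left_le_one_le)
  have bc: "continuous_map X euclideanreal (\<lambda>x. \<Sum>i<n. b i x)" for n
    unfolding b_def by (intro continuous_intros hc) auto
  have sm: "summable (\<lambda>n. (1/2::real)^n)" by simp
  have summ: "summable (\<lambda>n. b n x)" if "x \<in> topspace X" for x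
    by (rule summable_comparison_test[OF _ sm]) (use b0[OF that] in auto)
  define a where "a x = (\<Sum>n. b n x)" for x
  have ul: "uniform_limit (topspace X) (\<lambda>n x. \<Sum>i<n. b i x) a sequentially"
    unfolding a_def by (rule Weierstrass_m_test[OF _ sm]) (use b0 in auto)
  have "continuous_map X (Met_TC.mtopology :: real topology) a"
  proof (rule Met_TC.continuous_map_uniform_limit)
    show "\<forall>\<^sub>F n in sequentially. continuous_map X (Met_TC.mtopology :: real topology) (\<lambda>x. \<Sum>i<n. b i x)"
      using bc by simp
    show "\<forall>\<^sub>F n in sequentially. \<forall>x\<in>topspace X. a x \<in> UNIV \<and> dist (\<Sum>i<n. b i x) (a x) < e"
      if "e > 0" for e
      using uniform_limitD[OF ul that] by simp
  qed simp
  then have ac: "continuous_map X euclideanreal a" by simp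
  show ?thesis
  proof (rule that[OF ac])
    show "a x = 0" if "x \<in> C" for x
    proof -
      have "b n x = 0" for n using h(3)[of n] that by (auto simp: b_def)
      then show ?thesis by (simp add: a_def)
    qed
    show "a v > 0" if v: "v \<in> Y" for v
    proof -
      obtain n where n: "v = y n" using v ran by blast
      have vX: "v \<in> topspace X" using v Y by blast
      have "b n v > 0" by (simp add: b_def n h(2))
      then show ?thesis
        unfolding a_def using suminf_pos2[OF summ[OF vX] b0(1)[OF vX]] by blast
    qed
  qed
qed

text \<open>
  The difference \<open>d\<close> of two functions as above is positive on \<open>Y\<close> and negative on \<open>Z\<close>. Its sign
  is a bounded continuous function on the cozero-set where \<open>d \<noteq> 0\<close>, and the extension of the
  sign to \<open>X\<close> separates the closures.
\<close>

lemma F_space_separated_countable_closures_disjoint: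
  assumes F: "F_space X" and Y: "countable Y" "Y \<subseteq> topspace X"
    and Z: "countable Z" "Z \<subseteq> topspace X"
    and sep: "Y \<inter> X closure_of Z = {}" "Z \<inter> X closure_of Y = {}"
  shows "X closure_of Y \<inter> X closure_of Z = {}"
proof -
  have creg: "completely_regular_space X" using F by (simp add: F_space_def)
  obtain a where a: "continuous_map X euclideanreal a"
    "\<And>x. x \<in> X closure_of Z \<Longrightarrow> a x = 0" "\<And>y. y \<in> Y \<Longrightarrow> a y > 0"
    using continuous_map_positive_on_countable[OF creg closedin_closure_of Y sep(1)] by metis
  obtain b where b: "continuous_map X euclideanreal b"
    "\<And>x. x \<in> X closure_of Y \<Longrightarrow> b x = 0" "\<And>y. y \<in> Z \<Longrightarrow> b y > 0"
    using continuous_map_positive_on_countable[OF creg closedin_closure_of Z sep(2)] by metis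
  define d where "d x = a x - b x" for x
  have dc: "continuous_map X euclideanreal d"
    unfolding d_def by (intro continuous_intros a b)
  have dY: "d y > 0" if "y \<in> Y" for y
    using a(3)[OF that] b(2)[of y] closure_of_subset[OF Y(2)] that by (auto simp: d_def)
  have dZ: "d z < 0" if "z \<in> Z" for z
    using b(3)[OF that] a(2)[of z] closure_of_subset[OF Z(2)] that by (auto simp: d_def)
  define W where "W = {x \<in> topspace X. d x \<noteq> 0}"
  have "cozero_set_in X W"
    unfolding cozero_set_in_def zero_set_in_def W_def
    by (rule exI[of _ "{x \<in> topspace X. d x = 0}"]) (use dc in auto)
  then have emb: "Cstar_embedded_in X W" using F by (simp add: F_space_def)
  have "continuous_map (subtopology X W) (top_of_set (UNIV - {0})) d"
    using dc by (auto simp: continuous_map_in_subtopology W_def continuous_map_from_subtopology)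
  moreover have "continuous_map (top_of_set (UNIV - {0::real})) euclideanreal sgn"
    by (auto intro!: continuous_intros)
  ultimately have sc: "continuous_map (subtopology X W) euclideanreal (sgn \<circ> d)"
    by (rule continuous_map_compose)
  have "bounded ((sgn \<circ> d) ` W)"
    by (rule boundedI[of _ 1]) (auto simp: norm_sgn)
  with sc emb obtain h where h: "continuous_map X euclideanreal h" "\<forall>x\<in>W. h x = sgn (d x)"
    unfolding Cstar_embedded_in_def by (metis comp_apply)
  have "h ` (X closure_of Y) \<subseteq> euclideanreal closure_of (h ` Y)"
    by (rule continuous_map_image_closure_subset[OF h(1)])
  also have "h ` Y \<subseteq> {1}"
    using dY h(2) Y(2) by (fastforce simp: W_def)
  then have "euclideanreal closure_of (h ` Y) \<subseteq> {1}"
    by (simp add: closure_minimal)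
  finally have 1: "h ` (X closure_of Y) \<subseteq> {1}" .
  have "h ` (X closure_of Z) \<subseteq> euclideanreal closure_of (h ` Z)"
    by (rule continuous_map_image_closure_subset[OF h(1)])
  also have "h ` Z \<subseteq> {-1}"
    using dZ h(2) Z(2) by (fastforce simp: W_def)
  then have "euclideanreal closure_of (h ` Z) \<subseteq> {-1}"
    by (simp add: closure_minimal)
  finally have 2: "h ` (X closure_of Z) \<subseteq> {-1}" .
  show ?thesis using 1 2 by fastforce
qed

section \<open>Disjoint open families in nowhere c.c.c. spaces\<close>

lemma nowhere_ccc_space_uncountable_disjoint_family:
  assumes "nowhere_ccc_space X" "openin X W" "W \<noteq> {}"
  obtains \<B> where "uncountable \<B>" "pairwise disjnt \<B>"
    "\<And>B. B \<in> \<B> \<Longrightarrow> openin X B \<and> B \<subseteq> W"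
proof -
  have "\<not> ccc_space (subtopology X W)" using assms by (auto simp: nowhere_ccc_space_def)
  then obtain \<B> where "\<forall>U\<in>\<B>. openin (subtopology X W) U \<and> U \<noteq> {}" "pairwise disjnt \<B>" "uncountable \<B>"
    by (auto simp: ccc_space_def)
  then show ?thesis using that[of \<B>] assms(2) by (auto simp: openin_open_subtopology)
qed

text \<open>
  By Zorn's lemma, take a maximal disjoint open family of which each \<open>W n\<close> meets either no member or
  uncountably many. If some \<open>W n\<close> met none, then an uncountable disjoint family inside \<open>W n\<close> could
  be added, after discarding the countably many members that meet a \<open>W m\<close> which meets only
  countably many of them.
\<close>

lemma disjoint_open_family_meeting_uncountably:
  assumes nccc: "nowhere_ccc_space X" and W: "\<And>n::nat. openin X (W n)" "\<And>n. W n \<noteq> {}"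
  obtains \<A> where "\<And>A. A \<in> \<A> \<Longrightarrow> openin X A" "pairwise disjnt \<A>"
    "\<And>n. uncountable {A \<in> \<A>. A \<inter> W n \<noteq> {}}"
proof -
  define meet where "meet \<A> n = {A \<in> \<A>. A \<inter> W n \<noteq> {}}" for \<A> n
  define \<FF> where "\<FF> = {\<A>. (\<forall>A\<in>\<A>. openin X A) \<and> pairwise disjnt \<A> \<and>
      (\<forall>n. meet \<A> n = {} \<or> uncountable (meet \<A> n))}"
  have "\<exists>\<A>\<in>\<FF>. \<forall>\<B>\<in>\<FF>. \<A> \<subseteq> \<B> \<longrightarrow> \<B> = \<A>"
  proof (rule subset_Zorn')
    fix \<C> assume ch: "subset.chain \<FF> \<C>"
    then have sub: "\<C> \<subseteq> \<FF>" and lin: "\<And>\<A> \<B>. \<A> \<in> \<C> \<Longrightarrow> \<B> \<in> \<C> \<Longrightarrow> \<A> \<subseteq> \<B> \<or> \<B> \<subseteq> \<A>"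
      unfolding subset_chain_def by blast+
    have "pairwise disjnt (\<Union>\<C>)"
    proof (rule pairwiseI)
      fix A B assume "A \<in> \<Union>\<C>" "B \<in> \<Union>\<C>" and ne: "A \<noteq> B"
      then obtain \<A> where "\<A> \<in> \<C>" "A \<in> \<A>" "B \<in> \<A>" using lin by blast
      then show "disjnt A B" using sub ne unfolding \<FF>_def pairwise_def by blast
    qed
    moreover have "meet (\<Union>\<C>) n = {} \<or> uncountable (meet (\<Union>\<C>) n)" for n
    proof (cases "meet (\<Union>\<C>) n = {}")
      case False
      then obtain \<A> where \<A>: "\<A> \<in> \<C>" "meet \<A> n \<noteq> {}" by (auto simp: meet_def)
      then have "uncountable (meet \<A> n)" using sub by (auto simp: \<FF>_def)
      moreover have "meet \<A> n \<subseteq> meet (\<Union>\<C>) n" using \<A>(1) by (auto simp: meet_def)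
      ultimately show ?thesis using countable_subset by blast
    qed simp
    moreover have "\<forall>A\<in>\<Union>\<C>. openin X A" using sub by (auto simp: \<FF>_def)
    ultimately show "\<Union>\<C> \<in> \<FF>" unfolding \<FF>_def by blast
  qed
  then obtain \<A> where \<A>: "\<A> \<in> \<FF>" and mx: "\<And>\<B>. \<B> \<in> \<FF> \<Longrightarrow> \<A> \<subseteq> \<B> \<Longrightarrow> \<B> = \<A>" by blast
  have "uncountable (meet \<A> n)" for n
  proof (rule ccontr)
    assume "\<not> uncountable (meet \<A> n)"
    then have none: "meet \<A> n = {}" using \<A> by (auto simp: \<FF>_def)
    obtain \<B> where \<B>: "uncountable \<B>" "pairwise disjnt \<B>"
      "\<And>B. B \<in> \<B> \<Longrightarrow> openin X B \<and> B \<subseteq> W n"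
      using nowhere_ccc_space_uncountable_disjoint_family[OF nccc W] by blast
    define N where "N = (\<Union>m\<in>{m. countable (meet \<B> m)}. meet \<B> m)"
    have cN: "countable N" unfolding N_def by (rule countable_UN) auto
    \<comment> \<open>without the empty set, every member of \<open>\<B>'\<close> meets \<open>W n\<close>, hence is not in \<open>\<A>\<close>\<close>
    define \<B>' where "\<B>' = \<B> - N - {{}}"
    have unc: "uncountable \<B>'"
      unfolding \<B>'_def using \<B>(1) cN by (simp add: uncountable_minus_countable)
    have dich: "meet \<B>' m = {} \<or> uncountable (meet \<B>' m)" for m
    proof (cases "countable (meet \<B> m)")
      case True
      then show ?thesis by (auto simp: \<B>'_def N_def meet_def)
    next
      case False
      have "meet \<B>' m = meet \<B> m - (N \<union> {{}})" by (auto simp: \<B>'_def meet_def)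
      then show ?thesis using False cN by (simp add: uncountable_minus_countable)
    qed
    have cross: "disjnt A B" if "A \<in> \<A>" "B \<in> \<B>'" for A B
      using that none \<B>(3) by (fastforce simp: meet_def \<B>'_def disjnt_def)
    have "\<A> \<union> \<B>' \<in> \<FF>"
    proof -
      have "pairwise disjnt (\<A> \<union> \<B>')"
      proof (rule pairwiseI)
        fix A B assume AB: "A \<in> \<A> \<union> \<B>'" "B \<in> \<A> \<union> \<B>'" and ne: "A \<noteq> B"
        have "pairwise disjnt \<A>" "pairwise disjnt \<B>'"
          using \<A> \<B>(2) by (auto simp: \<FF>_def \<B>'_def pairwise_def)
        then show "disjnt A B"
          using AB ne cross[of A B] cross[of B A] by (auto simp: pairwise_def disjnt_sym)
      qed
      moreover have "meet (\<A> \<union> \<B>') m = meet \<A> m \<union> meet \<B>' m" for m by (auto simp: meet_def)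
      then have "meet (\<A> \<union> \<B>') m = {} \<or> uncountable (meet (\<A> \<union> \<B>') m)" for m
        using \<A> dich[of m] by (auto simp: \<FF>_def)
      moreover have "\<forall>A\<in>\<A> \<union> \<B>'. openin X A" using \<A> \<B>(3) by (auto simp: \<FF>_def \<B>'_def)
      ultimately show ?thesis unfolding \<FF>_def by blast
    qed
    then have "\<B>' \<subseteq> \<A>" using mx by blast
    then have "\<B>' \<subseteq> meet \<A> n" using \<B>(3) by (fastforce simp: \<B>'_def meet_def)
    then show False using none unc by auto
  qed
  then show ?thesis using that[of \<A>] \<A> by (auto simp: \<FF>_def meet_def)
qed

section \<open>Free selections\<close>

text \<open>
  Either some fibre of \<open>e\<close> is uncountable, and \<open>R\<close> shrinks to it with the value as the only
  element of \<open>P\<close>, or all fibres are countable and \<open>P\<close> is empty. In both cases \<open>e\<close> takes values in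
  a countable set outside \<open>P\<close> only countably often, which is what the greedy choice of
  \<open>free_selection\<close> requires.
\<close>

lemma thin_to_constant_or_countable_to_one:
  assumes "uncountable R"
  obtains R' P where "R' \<subseteq> R" "uncountable R'" "countable P"
    "\<And>T. countable T \<Longrightarrow> T \<inter> P = {} \<Longrightarrow> countable {A \<in> R'. e A \<in> T}"
proof (cases "\<exists>c. uncountable {A \<in> R. e A = c}")
  case True
  then obtain c where c: "uncountable {A \<in> R. e A = c}" by blast
  show ?thesis
  proof (rule that[of "{A \<in> R. e A = c}" "{c}"])
    fix T assume "T \<inter> {c} = {}"
    then have "{A \<in> {A \<in> R. e A = c}. e A \<in> T} = {}" by auto
    then show "countable {A \<in> {A \<in> R. e A = c}. e A \<in> T}" by (metis countable_empty)
  qed (use c in auto)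
next
  case False
  show ?thesis
  proof (rule that[of R "{}"])
    fix T :: "'b set" assume "countable T"
    then have "countable (\<Union>c\<in>T. {A \<in> R. e A = c})" using False by auto
    moreover have "{A \<in> R. e A \<in> T} = (\<Union>c\<in>T. {A \<in> R. e A = c})" by auto
    ultimately show "countable {A \<in> R. e A \<in> T}" by simp
  qed (use assms in auto)
qed

text \<open>
  A greedy choice of \<open>A k\<close> can avoid the values of \<open>e\<close> at the earlier choices, but its own value
  may be forced to be an earlier choice when \<open>e (\<nu> k)\<close> is constant. So each row is thinned first,
  and no element of \<open>Q\<close>, the countable set of all the constant values, is ever chosen.
\<close>

lemma free_selection:
  fixes R :: "nat \<Rightarrow> 'b set" and e :: "nat \<Rightarrow> 'b \<Rightarrow> 'b" and \<nu> :: "nat \<Rightarrow> nat"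
  assumes R: "\<And>n. uncountable (R n)"
  obtains A where "\<And>k. A k \<in> R (\<nu> k)" "inj A" "\<And>k l. k \<noteq> l \<Longrightarrow> e (\<nu> k) (A k) \<noteq> A l"
proof -
  have "\<forall>n. \<exists>R' P. R' \<subseteq> R n \<and> uncountable R' \<and> countable P \<and>
      (\<forall>T. countable T \<and> T \<inter> P = {} \<longrightarrow> countable {A \<in> R'. e n A \<in> T})"
    using thin_to_constant_or_countable_to_one[OF R] by metis
  then obtain R' P where R': "\<And>n. R' n \<subseteq> R n" "\<And>n. uncountable (R' n)" "\<And>n. countable (P n)"
    "\<And>n T. countable T \<Longrightarrow> T \<inter> P n = {} \<Longrightarrow> countable {A \<in> R' n. e n A \<in> T}"
    by metis
  define Q where "Q = (\<Union>n. P n)"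
  have cQ: "countable Q" using R'(3) by (auto simp: Q_def)
  define good where "good A k B \<longleftrightarrow> B \<in> R' (\<nu> k) \<and> B \<notin> Q \<and> B \<notin> A ` {..<k} \<and>
      B \<notin> (\<lambda>l. e (\<nu> l) (A l)) ` {..<k} \<and> e (\<nu> k) B \<notin> A ` {..<k}" for A k B
  have "\<exists>A. \<forall>k. good A k (A k)"
  proof (rule dependent_wf_choice[OF wf_less])
    fix A A' :: "nat \<Rightarrow> 'b" and k B
    assume "\<And>l. (l, k) \<in> {(x, y). x < y} \<Longrightarrow> A l = A' l"
    then have eq: "\<And>l. l < k \<Longrightarrow> A l = A' l" by auto
    have "A ` {..<k} = A' ` {..<k}"
      "(\<lambda>l. e (\<nu> l) (A l)) ` {..<k} = (\<lambda>l. e (\<nu> l) (A' l)) ` {..<k}"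
      using eq by (auto simp: image_def)
    then show "good A k B = good A' k B" by (simp add: good_def)
  next
    fix k and A :: "nat \<Rightarrow> 'b"
    assume "\<And>l. (l, k) \<in> {(x, y). x < y} \<Longrightarrow> good A l (A l)"
    then have "A ` {..<k} \<inter> Q = {}" by (auto simp: good_def)
    then have "countable {B \<in> R' (\<nu> k). e (\<nu> k) B \<in> A ` {..<k}}"
      by (intro R'(4)) (auto simp: Q_def)
    then have "countable (Q \<union> A ` {..<k} \<union> (\<lambda>l. e (\<nu> l) (A l)) ` {..<k} \<union>
        {B \<in> R' (\<nu> k). e (\<nu> k) B \<in> A ` {..<k}})" (is "countable ?X")
      using cQ by simp
    then have "uncountable (R' (\<nu> k) - ?X)" using R'(2) by (simp add: uncountable_minus_countable)
    then have "R' (\<nu> k) - ?X \<noteq> {}" by (metis countable_empty)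
    then show "\<exists>B. good A k B" unfolding good_def by blast
  qed
  then obtain A where A: "\<And>k. good A k (A k)" by blast
  show ?thesis
  proof (rule that[of A])
    show "A k \<in> R (\<nu> k)" for k using A[of k] R'(1) by (auto simp: good_def)
    show "inj A"
    proof (rule linorder_injI)
      show "A k \<noteq> A l" if "k < l" for k l
        using A[of l] that unfolding good_def by (metis imageI lessThan_iff)
    qed
    show "e (\<nu> k) (A k) \<noteq> A l" if "k \<noteq> l" for k l
    proof (cases "k < l")
      case True
      then show ?thesis using A[of l] unfolding good_def by (metis (no_types, lifting) imageI lessThan_iff)
    next
      case False
      then have "l < k" using that by simp
      then show ?thesis using A[of k] unfolding good_def by (metis imageI lessThan_iff)
    qed
  qed
qed

section \<open>Limits along branches of the binary tree\<close>

text \<open>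
  The branch of the binary tree given by the characteristic function of \<open>r\<close>, as a set of natural
  numbers: its node at level \<open>n\<close> is the pair of \<open>n\<close> and a code for \<open>r\<close> below \<open>n\<close>.
\<close>

definition branch :: "nat set \<Rightarrow> nat set" where
  "branch r = range (\<lambda>n. prod_encode (n, set_encode (r \<inter> {..<n})))"

lemma branch_row: "\<exists>k\<in>branch r. fst (prod_decode k) = n"
  by (auto simp: branch_def)

lemma finite_branch_Int:
  assumes "r \<noteq> r'"
  shows "finite (branch r \<inter> branch r')"
proof -
  obtain m where m: "m \<in> r \<longleftrightarrow> m \<notin> r'" using assms by blast
  have "branch r \<inter> branch r' \<subseteq> (\<lambda>n. prod_encode (n, set_encode (r \<inter> {..<n}))) ` {..m}"
  proof
    fix k assume "k \<in> branch r \<inter> branch r'"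
    then obtain n where n: "k = prod_encode (n, set_encode (r \<inter> {..<n}))"
      "set_encode (r \<inter> {..<n}) = set_encode (r' \<inter> {..<n})"
      by (auto simp: branch_def)
    then have "r \<inter> {..<n} = r' \<inter> {..<n}"
      by (metis finite_Int finite_lessThan set_encode_inverse)
    then have "n \<le> m" using m by (metis IntD1 IntI lessThan_iff not_le)
    then show "k \<in> (\<lambda>n. prod_encode (n, set_encode (r \<inter> {..<n}))) ` {..m}" using n by blast
  qed
  then show ?thesis by (rule finite_subset) simp
qed

text \<open>
  If \<open>z k\<close> is a limit of \<open>y\<close> along two branches, then removing their finite intersection \<open>I\<close> keeps
  it a limit along both, because the closed set \<open>y ` I\<close> does not contain it. But then it is in the
  closures of two disjoint subsets of a countable discrete set. So each \<open>z k\<close> rules out at most one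
  branch.
\<close>

lemma F_space_branch_avoiding:
  assumes F: "F_space X" and V: "\<And>k::nat. openin X (V k)" "\<And>k. y k \<in> V k"
    and dis: "\<And>k l. k \<noteq> l \<Longrightarrow> V k \<inter> V l = {}"
    and zV: "\<And>(k::nat) l. z k \<notin> V l"
  obtains r where "\<And>k. z k \<notin> X closure_of (y ` branch r)"
proof -
  have yX: "y ` E \<subseteq> topspace X" for E using V openin_subset by blast
  have sep: "y ` E \<inter> X closure_of (y ` E') = {}" if "E \<inter> E' = {}" for E E'
  proof -
    have "y k \<notin> X closure_of (y ` E')" if "k \<in> E" for k
    proof -
      have "y l \<notin> V k" if "l \<in> E'" for l
        using dis[of k l] V(2)[of l] \<open>k \<in> E\<close> \<open>E \<inter> E' = {}\<close> that by auto
      then have "V k \<inter> y ` E' = {}" by auto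
      then show ?thesis using V openin_Int_closure_of_eq_empty[OF V(1)] by blast
    qed
    then show ?thesis by blast
  qed
  have cl: "X closure_of (y ` E) \<inter> X closure_of (y ` E') = {}" if "E \<inter> E' = {}" for E E'
    using F_space_separated_countable_closures_disjoint[OF F _ yX _ yX sep[OF that]] sep[of E' E] that
    by (simp add: Int_commute)
  have T1: "t1_space X" using F Hausdorff_imp_t1_space by (auto simp: F_space_def)
  have unique: "r = r'" if z: "z k \<in> X closure_of (y ` branch r)" "z k \<in> X closure_of (y ` branch r')"
    for k r r'
  proof (rule ccontr)
    assume "r \<noteq> r'"
    define I where "I = branch r \<inter> branch r'"
    have "finite I" using finite_branch_Int[OF \<open>r \<noteq> r'\<close>] by (simp add: I_def)
    then have "X closure_of (y ` I) = y ` I"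
      using T1 yX by (intro closure_of_closedin) (simp add: t1_space_closedin_finite)
    then have nI: "z k \<notin> X closure_of (y ` I)" using zV V(2) by (metis imageE)
    have "z k \<in> X closure_of (y ` (S - I))" if "z k \<in> X closure_of (y ` S)" for S
    proof -
      have "y ` S \<subseteq> y ` I \<union> y ` (S - I)" by blast
      then have "X closure_of (y ` S) \<subseteq> X closure_of (y ` I) \<union> X closure_of (y ` (S - I))"
        by (metis closure_of_mono closure_of_Un)
      then show ?thesis using that nI by blast
    qed
    then have "z k \<in> X closure_of (y ` (branch r - I)) \<inter> X closure_of (y ` (branch r' - I))"
      using z by blast
    then show False using cl[of "branch r - I" "branch r' - I"] by (auto simp: I_def)
  qed
  define bad where "bad k = {r. z k \<in> X closure_of (y ` branch r)}" for k
  have "countable (bad k)" for k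
  proof (cases "bad k = {}")
    case False
    then obtain r where "r \<in> bad k" by blast
    then have "bad k \<subseteq> {r}" using unique[of k] by (auto simp: bad_def)
    then show ?thesis by (metis countable_empty countable_insert countable_subset)
  qed simp
  then have "countable (\<Union>k. bad k)" by simp
  moreover have "uncountable (UNIV :: nat set set)"
  proof
    assume "countable (UNIV :: nat set set)"
    then have "range (from_nat_into (UNIV :: nat set set)) = Pow UNIV"
      by (simp add: range_from_nat_into)
    then show False using Cantors_theorem by blast
  qed
  ultimately have "(\<Union>k. bad k) \<noteq> UNIV" by metis
  then show ?thesis using that by (auto simp: bad_def)
qed

section \<open>The neighbourhood in the function space\<close>

lemma open_set_separating_maps:
  assumes Haus: "Hausdorff_space Y" and f: "f \<in> continuous_maps X Y" and g: "g \<in> continuous_maps X Y"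
    and ne: "f \<noteq> g"
  obtains U where "openin X U" "U \<noteq> {}" "f ` U \<inter> g ` U = {}"
proof -
  have fc: "continuous_map X Y f" "continuous_map X Y g" using f g by (auto simp: continuous_maps_def)
  obtain x where x: "x \<in> topspace X" "f x \<noteq> g x"
    using ne f g by (auto simp: continuous_maps_def intro: extensionalityI)
  then obtain P Q where PQ: "openin Y P" "openin Y Q" "f x \<in> P" "g x \<in> Q" "disjnt P Q"
    using Haus continuous_map_funspace[OF fc(1)] continuous_map_funspace[OF fc(2)]
    unfolding Hausdorff_space_def by (metis PiE)
  define U where "U = {t \<in> topspace X. f t \<in> P} \<inter> {t \<in> topspace X. g t \<in> Q}"
  show ?thesis
  proof (rule that[of U])
    show "openin X U" unfolding U_def
      using PQ fc by (intro openin_Int openin_continuous_map_preimage)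
    show "U \<noteq> {}" using x PQ by (auto simp: U_def)
    show "f ` U \<inter> g ` U = {}" using PQ(5) by (auto simp: U_def disjnt_def)
  qed
qed

theorem theorem6p13:
  fixes X :: "'a topology" and f :: "'a \<Rightarrow> 'a"
  assumes "compact_space X" and "Hausdorff_space X"
    and "nowhere_ccc_space X" and "F_space X"
    and "f \<in> continuous_maps X X"
    and "open_map X X f"
    and "finite_to_one_on (topspace X) (topspace X) f"
  shows "weak_P_point (compact_open_topology X X) f"
  unfolding weak_P_point_def topspace_compact_open_topology
proof (intro conjI allI impI)
  show "f \<in> continuous_maps X X" by fact
next
  fix D assume D: "D \<subseteq> continuous_maps X X \<and> countable D \<and> f \<notin> D"
  show "f \<notin> compact_open_topology X X closure_of D"
  proof (cases "D = {}")
    case False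
    define g where "g = from_nat_into D"
    have ran: "range g = D" unfolding g_def using D False by (intro range_from_nat_into) auto
    have gc: "g n \<in> continuous_maps X X" "f \<noteq> g n" for n using ran D by auto
    have gX: "g n x \<in> topspace X" if "x \<in> topspace X" for n x
      using gc(1)[of n] that by (auto simp: continuous_maps_def continuous_map_def)
    have fcont: "continuous_map X X f" using assms(5) by (simp add: continuous_maps_def)
    have "\<forall>n. \<exists>U. openin X U \<and> U \<noteq> {} \<and> f ` U \<inter> g n ` U = {}"
      using open_set_separating_maps[OF assms(2,5) gc] by metis
    then obtain U where U: "\<And>n. openin X (U n)" "\<And>n. U n \<noteq> {}" "\<And>n. f ` U n \<inter> g n ` U n = {}"
      by metis
    define W where "W n = f ` U n" for n
    have W: "openin X (W n)" "W n \<noteq> {}" for n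
      using assms(6) U by (auto simp: W_def open_map_def)
    obtain \<A> where \<A>: "\<And>A. A \<in> \<A> \<Longrightarrow> openin X A" "pairwise disjnt \<A>"
      "\<And>n. uncountable {A \<in> \<A>. A \<inter> W n \<noteq> {}}"
      using disjoint_open_family_meeting_uncountably[where W = W, OF assms(3) W] by blast
    have "\<forall>n A. \<exists>x. A \<inter> W n \<noteq> {} \<longrightarrow> x \<in> U n \<and> f x \<in> A" by (auto simp: W_def)
    then obtain \<xi> where \<xi>: "\<And>n A. A \<inter> W n \<noteq> {} \<Longrightarrow> \<xi> n A \<in> U n \<and> f (\<xi> n A) \<in> A" by metis
    \<comment> \<open>the member of \<open>\<A>\<close> that contains \<open>g n (\<xi> n A)\<close>, or the empty set if there is none\<close>
    define e where "e n A = \<Union>{B \<in> \<A>. g n (\<xi> n A) \<in> B}" for n A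
    \<comment> \<open>the level of the node \<open>k\<close> of the tree tells which \<open>g n\<close> the point \<open>x k\<close> is for\<close>
    define \<nu> where "\<nu> k = fst (prod_decode k)" for k
    obtain A where A: "\<And>k. A k \<in> {A \<in> \<A>. A \<inter> W (\<nu> k) \<noteq> {}}" "inj A"
      "\<And>k l. k \<noteq> l \<Longrightarrow> e (\<nu> k) (A k) \<noteq> A l"
      using free_selection[where R = "\<lambda>n. {A \<in> \<A>. A \<inter> W n \<noteq> {}}" and \<nu> = \<nu> and e = e, OF \<A>(3)]
      by blast
    define x where "x k = \<xi> (\<nu> k) (A k)" for k
    define y where "y k = f (x k)" for k
    define z where "z k = g (\<nu> k) (x k)" for k
    \<comment> \<open>the free selection keeps \<open>z k\<close> out of \<open>A l\<close> for \<open>l \<noteq> k\<close> only; the factor \<open>W (\<nu> k)\<close> is for \<open>l = k\<close>\<close>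
    define V where "V k = A k \<inter> W (\<nu> k)" for k
    have x: "x k \<in> U (\<nu> k)" "y k \<in> A k" for k
      using \<xi>[of "A k" "\<nu> k"] A(1)[of k] by (auto simp: x_def y_def)
    have xX: "x k \<in> topspace X" for k using x U openin_subset by blast
    have V: "openin X (V k)" "y k \<in> V k" for k
      using \<A>(1) A(1)[of k] W x[of k] by (auto simp: V_def W_def y_def)
    have yX: "y k \<in> topspace X" for k using V openin_subset by blast
    have zX: "z k \<in> topspace X" for k using gX xX by (auto simp: z_def)
    have Adis: "B = A l" if "B \<in> \<A>" "t \<in> B" "t \<in> A l" for B t l
    proof (rule ccontr)
      assume "B \<noteq> A l"
      moreover have "A l \<in> \<A>" using A(1)[of l] by simp
      ultimately have "disjnt B (A l)" using \<A>(2) \<open>B \<in> \<A>\<close> by (metis pairwiseD)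
      then show False using that by (auto simp: disjnt_def)
    qed
    have Vdis: "V k \<inter> V l = {}" if "k \<noteq> l" for k l
    proof -
      have "A k \<noteq> A l" using A(2) that by (auto dest: injD)
      then show ?thesis using Adis[of "A k"] A(1)[of k] by (auto simp: V_def)
    qed
    have zV: "z k \<notin> V l" for k l
    proof
      assume zl: "z k \<in> V l"
      show False
      proof (cases "k = l")
        case True
        have "z k \<in> g (\<nu> k) ` U (\<nu> k)" using x by (auto simp: z_def)
        then show False using True zl U(3)[of "\<nu> k"] by (auto simp: V_def W_def)
      next
        case False
        have "z k \<in> A l" using zl by (simp add: V_def)
        then have "{B \<in> \<A>. z k \<in> B} = {A l}" using Adis A(1)[of l] by blast
        then have "e (\<nu> k) (A k) = A l" by (simp add: e_def z_def x_def)
        then show False using A(3) False by blast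
      qed
    qed
    obtain r where r: "\<And>k. z k \<notin> X closure_of (y ` branch r)"
      using F_space_branch_avoiding[where V = V and y = y and z = z, OF assms(4) V Vdis zV] by blast
    define S where "S = branch r"
    have "y k \<notin> X closure_of (z ` S)" for k
    proof -
      have "V k \<inter> z ` S = {}" using zV by blast
      then show ?thesis using V openin_Int_closure_of_eq_empty[OF V(1)] by blast
    qed
    then have disj: "X closure_of (y ` S) \<inter> X closure_of (z ` S) = {}"
      using r xX yX zX
      by (intro F_space_separated_countable_closures_disjoint[OF assms(4)]) (auto simp: S_def)
    define C where "C = X closure_of (x ` S)"
    define G where "G = topspace X - X closure_of (z ` S)"
    define N where "N = {h \<in> continuous_maps X X. h ` C \<subseteq> G}"
    have "compactin X C"
      unfolding C_def by (rule closedin_compact_space[OF assms(1) closedin_closure_of])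
    moreover have "openin X G" unfolding G_def by (simp add: openin_diff)
    ultimately have "openin (compact_open_topology X X) N"
      unfolding compact_open_topology_def N_def by (intro topology_generated_by_Basis) blast
    moreover have "f \<in> N"
    proof -
      have "f ` C \<subseteq> X closure_of (f ` x ` S)"
        unfolding C_def by (rule continuous_map_image_closure_subset[OF fcont])
      also have "f ` x ` S = y ` S" by (auto simp: y_def)
      finally have "f ` C \<subseteq> G"
        using disj closure_of_subset_topspace[of X "y ` S"] unfolding G_def by blast
      then show ?thesis using assms(5) by (simp add: N_def)
    qed
    moreover have "N \<inter> D = {}"
    proof -
      have "g n \<notin> N" for n
      proof -
        obtain k where k: "k \<in> S" "\<nu> k = n" using branch_row[of r n] by (auto simp: S_def \<nu>_def)
        have "x k \<in> C" using k xX closure_of_subset[of "x ` S" X] by (auto simp: C_def)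
        moreover have "g n (x k) \<in> X closure_of (z ` S)"
          using k zX closure_of_subset[of "z ` S" X] by (auto simp: z_def)
        ultimately show ?thesis by (auto simp: N_def G_def)
      qed
      then show ?thesis using ran by blast
    qed
    ultimately show ?thesis by (metis disjoint_iff in_closure_of)
  qed simp
qed

end
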